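(* Let $m\ge 1$ and $1\le j\le m+1$ be integers. Put $a_0=1$, $b_0=\frac{2j+1}{3}$, and define $a_1,b_1,\dots,a_m,b_m$ recursively by $$2n\,a_n-(2m+5-2n)\,a_{n-1}=-3b_0b_{n-1},\qquad (2n+3)\,b_n-(2m+2-2n)\,b_{n-1}=3b_0a_n\qquad(1\le n\le m).$$ Let $$\psi^{(m)}_{j,+}(x)=\langle x\rangle^{-(3+2m)}\Big[\Big(\sum_{n=0}^m a_n|x|^{2n}\Big)I_2+\Big(\sum_{n=0}^m b_n|x|^{2n}\Big)\,i\sigma\cdot x\Big]\phi_0,\qquad x\in\mathbb R^3,$$ with $\phi_0={}^t(1,0)$, and let, writing $\psi=\psi^{(m)}_{j,+}$, $$A^{(m)}_{j,+}(x)=\frac{2j+1}{\langle x\rangle^2\,|\psi(x)|^2}\big(\psi(x)\cdot\sigma_1\psi(x),\ \psi(x)\cdot\sigma_2\psi(x),\ \psi(x)\cdot\sigma_3\psi(x)\big).$$ Then $\psi^{(m)}_{j,+}$ is a zero mode of the Weyl-Dirac operator $H_{A^{(m)}_{j,+}}=\sigma\cdot(D-A^{(m)}_{j,+})$.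
   Context: $\sigma=(\sigma_1,\sigma_2,\sigma_3)$ is the triple of Pauli matrices $$\sigma_1=\begin{pmatrix}0&1\\1&0\end{pmatrix},\quad \sigma_2=\begin{pmatrix}0&-i\\ i&0\end{pmatrix},\quad \sigma_3=\begin{pmatrix}1&0\\0&-1\end{pmatrix};$$ $D=-i\nabla$ on $\mathbb R^3$; $\sigma\cdot x=\sum_k x_k\sigma_k$; $I_2$ is the $2\times2$ identity matrix; $\langle x\rangle=\sqrt{1+|x|^2}$; for $a,b\in\mathbb C^2$, $a\cdot b=\overline{a_1}b_1+\overline{a_2}b_2$ and $|a|^2=a\cdot a$. For a vector potential $A=(A_1,A_2,A_3)$ on $\mathbb R^3$ with bounded measurable real components, the Weyl-Dirac operator is $H_A=\sigma\cdot(D-A)=\sum_{k=1}^3\sigma_k(D_k-A_k(x))$, acting in $[L^2(\mathbb R^3)]^2$ with domain $[H^1(\mathbb R^3)]^2$ ($H^1$ the Sobolev space of order 1). A zero mode of $H_A$ is an element $\psi\in[H^1(\mathbb R^3)]^2$ with $H_A\psi=0$. *)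

theory Defs
  imports "HOL-Analysis.Analysis"
begin

section \<open>The Sobolev space of order 1\<close>

definition partial_deriv :: "'n::finite \<Rightarrow> (real^'n \<Rightarrow> complex) \<Rightarrow> real^'n \<Rightarrow> complex" where
  "partial_deriv k f x = frechet_derivative f (at x) (axis k 1)"

text \<open>Differentiability is required at every level, so \<open>C_times n\<close> is the usual class of
  functions with continuous partial derivatives up to order \<open>n\<close>.\<close>

primrec C_times :: "nat \<Rightarrow> (real^'n::finite \<Rightarrow> complex) \<Rightarrow> bool" where
  "C_times 0 f \<longleftrightarrow> continuous_on UNIV f"
| "C_times (Suc n) f \<longleftrightarrow> (\<forall>x. f differentiable (at x)) \<and> (\<forall>k. C_times n (partial_deriv k f))"

definition test_function :: "(real^'n::finite \<Rightarrow> complex) \<Rightarrow> bool" where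
  "test_function \<phi> \<longleftrightarrow> (\<forall>n. C_times n \<phi>) \<and> compact (closure {x. \<phi> x \<noteq> 0})"

text \<open>Elements of \<open>L\<^sup>2\<close> and \<open>H\<^sup>1\<close> are represented by functions, identified when equal almost
  everywhere.\<close>

definition L2 :: "(real^'n::finite \<Rightarrow> complex) \<Rightarrow> bool" where
  "L2 f \<longleftrightarrow> f \<in> borel_measurable lebesgue \<and> integrable lebesgue (\<lambda>x. (cmod (f x))\<^sup>2)"

definition weak_partial :: "'n::finite \<Rightarrow> (real^'n \<Rightarrow> complex) \<Rightarrow> (real^'n \<Rightarrow> complex) \<Rightarrow> bool" where
  "weak_partial k f g \<longleftrightarrow>
     (\<forall>\<phi>. test_function \<phi> \<longrightarrow>
        (LINT x|lebesgue. f x * partial_deriv k \<phi> x) = - (LINT x|lebesgue. g x * \<phi> x))"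

definition H1 :: "(real^'n::finite \<Rightarrow> complex) \<Rightarrow> bool" where
  "H1 f \<longleftrightarrow> L2 f \<and> (\<forall>k. \<exists>g. L2 g \<and> weak_partial k f g)"


section \<open>The Weyl-Dirac operator\<close>

definition pauli :: "3 \<Rightarrow> complex^2^2" where
  "pauli k = (if k = 1 then vector [vector [0, 1], vector [1, 0]]
              else if k = 2 then vector [vector [0, - \<i>], vector [\<i>, 0]]
              else vector [vector [1, 0], vector [0, - 1]])"

definition sigma_dot :: "real^3 \<Rightarrow> complex^2^2" where
  "sigma_dot x = (\<Sum>k\<in>UNIV. x $ k *\<^sub>R pauli k)"

definition cdot :: "complex^2 \<Rightarrow> complex^2 \<Rightarrow> complex" where
  "cdot a b = (\<Sum>i\<in>UNIV. cnj (a $ i) * b $ i)"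

lemma cdot_self: "cdot a a = of_real ((norm a)\<^sup>2)"
proof -
  have "(norm a)\<^sup>2 = (\<Sum>i\<in>UNIV. (cmod (a $ i))\<^sup>2)"
    by (simp add: norm_vec_def L2_set_def sum_nonneg)
  moreover have "cnj z * z = of_real ((cmod z)\<^sup>2)" for z
    by (metis complex_norm_square mult.commute)
  ultimately show ?thesis
    by (simp add: cdot_def)
qed

lemma cdot_pauli_real: "cdot a (pauli k *v a) \<in> \<real>"
  by (auto simp: complex_is_Real_iff cdot_def pauli_def matrix_vector_mult_def sum_2 algebra_simps)

definition vector_potential :: "(real^3 \<Rightarrow> real^3) \<Rightarrow> bool" where
  "vector_potential A \<longleftrightarrow> A \<in> borel_measurable lebesgue \<and> bounded (range A)"

text \<open>\<open>weyl_dirac A \<psi> \<eta>\<close> is the graph of \<open>H\<^sub>A\<close>: \<open>\<psi>\<close> lies in the domain and \<open>H\<^sub>A \<psi> = \<eta>\<close> almost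
  everywhere.  Here \<open>d\<psi> k\<close> represents \<open>\<partial>\<^sub>k \<psi>\<close>, which is unique up to null sets.\<close>

definition weyl_dirac ::
  "(real^3 \<Rightarrow> real^3) \<Rightarrow> (real^3 \<Rightarrow> complex^2) \<Rightarrow> (real^3 \<Rightarrow> complex^2) \<Rightarrow> bool" where
  "weyl_dirac A \<psi> \<eta> \<longleftrightarrow>
     (\<forall>i. H1 (\<lambda>x. \<psi> x $ i)) \<and>
     (\<exists>d\<psi> :: 3 \<Rightarrow> real^3 \<Rightarrow> complex^2.
        (\<forall>k i. L2 (\<lambda>x. d\<psi> k x $ i) \<and> weak_partial k (\<lambda>x. \<psi> x $ i) (\<lambda>x. d\<psi> k x $ i)) \<and>
        (AE x in lebesgue.
           (\<Sum>k\<in>UNIV. pauli k *v ((- \<i>) *s d\<psi> k x - A x $ k *\<^sub>R \<psi> x)) = \<eta> x))"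

definition zero_mode :: "(real^3 \<Rightarrow> real^3) \<Rightarrow> (real^3 \<Rightarrow> complex^2) \<Rightarrow> bool" where
  "zero_mode A \<psi> \<longleftrightarrow> weyl_dirac A \<psi> (\<lambda>x. 0)"


section \<open>The explicit spinors and potentials\<close>

definition bracket :: "real^3 \<Rightarrow> real" where
  "bracket x = sqrt (1 + (norm x)\<^sup>2)"

definition psi_plus :: "nat \<Rightarrow> (nat \<Rightarrow> real) \<Rightarrow> (nat \<Rightarrow> real) \<Rightarrow> real^3 \<Rightarrow> complex^2" where
  "psi_plus m a b x =
     bracket x powi (- (3 + 2 * int m)) *\<^sub>R
       (((\<Sum>n=0..m. a n * norm x ^ (2 * n)) *\<^sub>R mat 1
         + (\<Sum>n=0..m. b n * norm x ^ (2 * n)) *\<^sub>R (mat \<i> ** sigma_dot x)) *v vector [1, 0])"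

text \<open>The components \<open>cdot (\<psi> x) (pauli k *v \<psi> x)\<close> are real by \<open>cdot_pauli_real\<close>, so \<open>Re\<close> loses
  nothing.\<close>

definition potential_plus :: "nat \<Rightarrow> (real^3 \<Rightarrow> complex^2) \<Rightarrow> real^3 \<Rightarrow> real^3" where
  "potential_plus j \<psi> x =
     ((2 * real j + 1) / ((bracket x)\<^sup>2 * (norm (\<psi> x))\<^sup>2)) *\<^sub>R
       (\<chi> k. Re (cdot (\<psi> x) (pauli k *v \<psi> x)))"

end

theory Submission
  imports Defs "HOL-Computational_Algebra.Polynomial"
begin

text \<open>Since \<open>(\<psi> \<cdot> \<sigma>\<psi>) \<cdot> \<sigma> \<psi> = |\<psi>|\<^sup>2 \<psi>\<close>, the zero mode equation is \<open>\<sigma> \<cdot> D \<psi> = (2j+1) \<langle>x\<rangle>\<^bsup>-2\<^esup> \<psi>\<close>.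
  With \<open>\<psi> = (P + Q i\<sigma> \<cdot> x)\<phi>\<^sub>0\<close> and \<open>s = |x|\<^sup>2\<close> it becomes a linear system of two ordinary differential
  equations for \<open>P\<close> and \<open>Q\<close>, of which the recursion for \<open>a\<^sub>n, b\<^sub>n\<close> is the coefficient form, except for
  the coefficient of \<open>s\<^sup>m\<close> in the first equation: this one demands \<open>a\<^sub>m = b\<^sub>0 b\<^sub>m\<close>, which holds
  because \<open>1 \<le> j \<le> m + 1\<close>. The system does not depend on \<open>m\<close>; with \<open>r = |x| = tan \<theta>\<close> and
  \<open>\<lambda> = 2j + 1\<close> its solution regular at the origin is a multiple of
  \<open>P = cos \<lambda>\<theta> - \<lambda> cot \<theta> sin \<lambda>\<theta>\<close>, \<open>r Q = \<lambda> cot \<theta> cos \<lambda>\<theta> - cot\<^sup>2 \<theta> sin \<lambda>\<theta>\<close>, and both are polynomials in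
  \<open>s\<close> of degree at most \<open>m\<close> times \<open>\<langle>x\<rangle>\<^bsup>-(3+2m)\<^esup>\<close>. These polynomials satisfy the recursion, so their
  coefficients are \<open>a\<^sub>n, b\<^sub>n\<close>. Their joint zeros would be zeros of \<open>(1 + ir)\<^bsup>\<lambda>\<^esup>\<close>. Finally \<open>\<psi>\<close> and its
  derivatives are \<open>O(\<langle>x\<rangle>\<^bsup>-2\<^esup>)\<close>, hence square integrable.\<close>

section \<open>The radial polynomials\<close>

text \<open>\<open>R\<close> and \<open>S\<close> are \<open>Re (1 + ir)\<^bsup>2j+1\<^esup>\<close> and \<open>Im (1 + ir)\<^bsup>2j+1\<^esup> / r\<close> as polynomials in \<open>s = r\<^sup>2\<close>;
  the two equations are the real and imaginary parts of \<open>(1 + r\<^sup>2) z' = i(2j+1)(1 - ir) z\<close> for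
  \<open>z = (1 + ir)\<^bsup>2j+1\<^esup>\<close>.\<close>

lemma cayley_polys:
  fixes j :: nat
  shows "\<exists>R S :: real poly.
     2 * [:1, 1:] * pderiv R = of_nat (2 * j + 1) * (R - S) \<and>
     [:1, 1:] * (S + 2 * [:0, 1:] * pderiv S) = of_nat (2 * j + 1) * ([:0, 1:] * S + R) \<and>
     coeff R 0 = 1 \<and> coeff S 0 = real (2 * j + 1) \<and> degree R \<le> j \<and> degree S \<le> j \<and>
     coeff R j = real (2 * j + 1) * coeff S j \<and>
     (\<forall>s. (poly R s)\<^sup>2 + s * (poly S s)\<^sup>2 = (1 + s) ^ (2 * j + 1))"
proof (induction j)
  case 0
  \<comment> \<open>For j = 0 the power is 1 + ir itself, with real part 1 and imaginary part r, so
    \<open>R\<close> and \<open>S\<close> are both 1.\<close>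
  show ?case
    by (rule exI[of _ 1], rule exI[of _ 1]) (auto simp: one_pCons)
next
  case (Suc j)
  then obtain R S :: "real poly" where
    1: "2 * [:1, 1:] * pderiv R = of_nat (2 * j + 1) * (R - S)" and
    2: "[:1, 1:] * (S + 2 * [:0, 1:] * pderiv S) = of_nat (2 * j + 1) * ([:0, 1:] * S + R)" and
    3: "coeff R 0 = 1" "coeff S 0 = real (2 * j + 1)" "degree R \<le> j" "degree S \<le> j"
       "coeff R j = real (2 * j + 1) * coeff S j" and
    4: "\<And>s. (poly R s)\<^sup>2 + s * (poly S s)\<^sup>2 = (1 + s) ^ (2 * j + 1)"
    by blast
  define X :: "real poly" where "X = [:0, 1:]"
  have X1: "[:1, 1:] = 1 + X" and dX: "pderiv X = 1"
    by (simp_all add: X_def one_pCons pderiv_pCons)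
  define L :: "real poly" where "L = of_nat (2 * j + 1)"
  have L2: "of_nat (2 * Suc j + 1) = L + 2"
    by (simp add: L_def)
  \<comment> \<open>Multiplication of \<open>R\<close> + ir \<open>S\<close> by (1 + ir)^2 = 1 - s +
    2ir gives the next pair.\<close>
  define R1 where "R1 = (1 - X) * R - 2 * X * S"
  define S1 where "S1 = (1 - X) * S + 2 * R"
  note e1 = 1[folded L_def X_def, unfolded X1] and e2 = 2[folded L_def X_def, unfolded X1]
  have d2: "pderiv (2::real poly) = 0"
    by (metis of_nat_numeral pderiv_of_nat)
  have dR: "pderiv R1 = (1 - X) * pderiv R - R - 2 * S - 2 * X * pderiv S"
    by (simp add: R1_def pderiv_diff pderiv_mult dX d2)
  have dS: "pderiv S1 = (1 - X) * pderiv S - S + 2 * pderiv R"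
    by (simp add: S1_def pderiv_diff pderiv_add pderiv_mult dX d2)
  \<comment> \<open>Both equations lie in the ideal generated by \<open>e1\<close> and
    \<open>e2\<close>, with the polynomials and their derivatives as independent
    indeterminates.\<close>
  have 5: "2 * (1 + X) * pderiv R1 = (L + 2) * (R1 - S1)"
    unfolding dR unfolding R1_def S1_def using e1 e2 by algebra
  have 6: "(1 + X) * (S1 + 2 * X * pderiv S1) = (L + 2) * (X * S1 + R1)"
    unfolding dS unfolding R1_def S1_def using e1 e2 by algebra
  have R1: "R1 = R - pCons 0 R - smult 2 (pCons 0 S)" and S1: "S1 = S - pCons 0 S + smult 2 R"
    by (simp_all add: R1_def S1_def X_def numeral_poly algebra_simps)
  show ?case
  proof (intro exI conjI allI)
    show "2 * [:1, 1:] * pderiv R1 = of_nat (2 * Suc j + 1) * (R1 - S1)"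
      "[:1, 1:] * (S1 + 2 * [:0, 1:] * pderiv S1) = of_nat (2 * Suc j + 1) * ([:0, 1:] * S1 + R1)"
      unfolding L2 X1 X_def[symmetric] using 5 6 by blast+
    show "degree R1 \<le> Suc j" "degree S1 \<le> Suc j"
      unfolding R1 S1 using 3(3,4)
      by (auto intro!: degree_diff_le degree_add_le order_trans[OF degree_smult_le] order_trans[OF degree_pCons_le])
    show "coeff R1 0 = 1" "coeff S1 0 = real (2 * Suc j + 1)"
      using 3 by (simp_all add: R1 S1)
    show "coeff R1 (Suc j) = real (2 * Suc j + 1) * coeff S1 (Suc j)"
      using 3 by (simp add: R1 S1 coeff_eq_0 algebra_simps)
    show "(poly R1 s)\<^sup>2 + s * (poly S1 s)\<^sup>2 = (1 + s) ^ (2 * Suc j + 1)" for s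
    proof -
      \<comment> \<open>Multiplicativity of the modulus: |(1 + ir)^2|^2 = (1 + s)^2.\<close>
      have "(poly R1 s)\<^sup>2 + s * (poly S1 s)\<^sup>2
          = (1 + s)\<^sup>2 * ((poly R s)\<^sup>2 + s * (poly S s)\<^sup>2)"
        by (simp add: R1 S1 power2_eq_square algebra_simps)
      then show ?thesis
        unfolding 4 by (simp add: power2_eq_square)
    qed
  qed
qed

text \<open>The polynomials are \<open>p = C(1 + s)\<^bsup>m+1-j\<^esup> (R - (2j+1) S)\<close> and
  \<open>s q = C(1 + s)\<^bsup>m+1-j\<^esup> ((2j+1) R - S)\<close>.\<close>

lemma weyl_dirac_radial_polys:
  fixes m j :: nat
  assumes "1 \<le> j" "j \<le> m + 1"
  shows "\<exists>p q :: real poly.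
     2 * [:1, 1:] * pderiv p = of_nat (2 * m + 3) * p - of_nat (2 * j + 1) * q \<and>
     2 * [:0, 1:] * [:1, 1:] * pderiv q - of_nat (2 * m + 3) * [:0, 1:] * q + 3 * [:1, 1:] * q
       = of_nat (2 * j + 1) * p \<and>
     coeff p 0 = 1 \<and> degree p \<le> m \<and> degree q \<le> m \<and>
     (\<forall>s\<ge>0. poly p s \<noteq> 0 \<or> poly q s \<noteq> 0)"
proof -
  obtain R S :: "real poly" where
    1: "2 * [:1, 1:] * pderiv R = of_nat (2 * j + 1) * (R - S)" and
    2: "[:1, 1:] * (S + 2 * [:0, 1:] * pderiv S) = of_nat (2 * j + 1) * ([:0, 1:] * S + R)" and
    3: "coeff R 0 = 1" "coeff S 0 = real (2 * j + 1)" "degree R \<le> j" "degree S \<le> j"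
       "coeff R j = real (2 * j + 1) * coeff S j" and
    4: "\<And>s. (poly R s)\<^sup>2 + s * (poly S s)\<^sup>2 = (1 + s) ^ (2 * j + 1)"
    using cayley_polys[of j] by blast
  define X :: "real poly" where "X = [:0, 1:]"
  have X1: "[:1, 1:] = 1 + X" and dX: "pderiv X = 1"
    by (simp_all add: X_def one_pCons pderiv_pCons)
  define l where "l = real (2 * j + 1)"
  define L :: "real poly" where "L = of_nat (2 * j + 1)"
  have L: "L = [:l:]"
    by (simp add: L_def l_def of_nat_poly del: of_nat_add of_nat_mult of_nat_Suc)
  have dL: "pderiv L = 0"
    by (simp add: L)
  have l2: "1 - l\<^sup>2 \<noteq> 0" "l > 0"
  proof -
    have "l > 1" using assms by (simp add: l_def)
    then show "1 - l\<^sup>2 \<noteq> 0" "l > 0"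
      by (auto simp: power2_eq_1_iff)
  qed
  note e1 = 1[folded L_def X_def, unfolded X1] and e2 = 2[folded L_def X_def, unfolded X1]
  \<comment> \<open>Normalises p(0) = 1: the constant term of \<open>R - L * S\<close> is 1 - l^2,
    which is nonzero because j >= 1 gives l > 1.\<close>
  define C :: "real poly" where "C = [:1 / (1 - l\<^sup>2):]"
  have dC: "pderiv C = 0" by (simp add: C_def)
  \<comment> \<open>(1 + s)^d turns the prefactor with exponent -(3 + 2m) into the one with exponent
    -(2j + 1), the natural weight of (1 + ir)^(2j+1).\<close>
  define d where "d = m + 1 - j"
  have dj: "d + j = m + 1" using assms by (simp add: d_def)
  define W where "W = (1 + X) ^ d"
  have dW: "(1 + X) * pderiv W = of_nat d * W"
  proof (cases d)
    case 0 then show ?thesis by (simp add: W_def)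
  next
    case (Suc n)
    have "pderiv W = of_nat d * (1 + X) ^ n"
      unfolding W_def Suc pderiv_power_Suc
      by (simp add: pderiv_add dX of_nat_poly add.commute)
    then show ?thesis by (simp add: W_def Suc mult.commute mult.left_commute)
  qed
  define p where "p = W * (C * (R - L * S))"
  define v where "v = W * (C * (L * R - S))"
  \<comment> \<open>The constant terms of \<open>L * R\<close> and \<open>S\<close> both equal 2j +
    1, so \<open>v\<close> is divisible by \<open>X\<close> and \<open>q\<close> is the
    quotient.\<close>
  have "coeff v 0 = 0"
    using 3 by (simp add: v_def coeff_mult_0 L l_def)
  then obtain q where q: "v = X * q"
    unfolding X_def by (metis dvd_def poly_eq_0_iff_dvd poly_0_coeff_0 minus_zero)
  have dp: "pderiv p = pderiv W * (C * (R - L * S)) + W * (C * (pderiv R - L * pderiv S))"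
    by (simp add: p_def pderiv_mult pderiv_diff dL dC algebra_simps)
  have dv: "pderiv v = pderiv W * (C * (L * R - S)) + W * (C * (L * pderiv R - pderiv S))"
    by (simp add: v_def pderiv_mult pderiv_diff dL dC algebra_simps)
  have M: "of_nat (2 * m + 3) = 2 * of_nat d + L"
  proof -
    have "2 * m + 3 = 2 * d + (2 * j + 1)" using dj by simp
    then show ?thesis by (simp only: L_def of_nat_add of_nat_mult of_nat_numeral)
  qed
  \<comment> \<open>The factor \<open>X\<close> lets \<open>v\<close> replace \<open>X * q\<close>,
    which has no closed form free of division; it is cancelled afterwards.\<close>
  have "X * (2 * (1 + X) * pderiv p) = X * (of_nat (2 * m + 3) * p - L * q)"
    unfolding M right_diff_distrib mult.left_commute[of X L q] q[symmetric]
    unfolding dp unfolding p_def v_def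
    using e1 e2 dW by algebra
  then have E1: "2 * (1 + X) * pderiv p = of_nat (2 * m + 3) * p - L * q"
    by (simp add: X_def)
  have dv': "pderiv v = q + X * pderiv q"
    by (simp add: q pderiv_mult dX)
  have "X * (2 * X * (1 + X) * pderiv q - of_nat (2 * m + 3) * X * q + 3 * (1 + X) * q)
    = X * (2 * (1 + X) * pderiv v) - of_nat (2 * m + 3) * X * v + (1 + X) * v"
    unfolding dv' by (simp add: q algebra_simps)
  also have "\<dots> = X * (L * p)"
    unfolding M dv unfolding p_def v_def
    using e1 e2 dW by algebra
  finally have E2: "2 * X * (1 + X) * pderiv q - of_nat (2 * m + 3) * X * q + 3 * (1 + X) * q = L * p"
    by (simp add: X_def)
  have degW: "degree W \<le> d"
    unfolding W_def by (rule order_trans[OF degree_power_le]) (simp add: X_def one_pCons)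
  \<comment> \<open>the top coefficients of \<open>R\<close> and \<open>(2j+1) S\<close> cancel\<close>
  have degp: "degree (C * (R - L * S)) \<le> j - 1"
  proof (rule degree_le, intro allI impI)
    fix i assume "i > j - 1"
    then have "i = j \<or> i > j" using assms by auto
    then show "coeff (C * (R - L * S)) i = 0"
      using 3 by (auto simp: C_def L coeff_eq_0 l_def)
  qed
  have degv: "degree (C * (L * R - S)) \<le> j"
    using 3 unfolding C_def L
    by (auto intro!: degree_diff_le order_trans[OF degree_smult_le])
  have "degree p \<le> m"
    unfolding p_def using degree_mult_le[of W "C * (R - L * S)"] degW degp dj assms by linarith
  \<comment> \<open>No top coefficient needs to cancel here: division by \<open>X\<close> takes the
    degree of \<open>v\<close> from m + 1 to that of \<open>q\<close>.\<close>
  moreover have "degree v \<le> m + 1"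
    unfolding v_def using degree_mult_le[of W "C * (L * R - S)"] degW degv dj by linarith
  then have "degree q \<le> m"
    by (cases "q = 0") (auto simp: q X_def)
  moreover have "coeff p 0 = 1"
  proof -
    have "coeff W 0 = 1"
      by (simp add: W_def X_def coeff_0_power)
    then show ?thesis
      using 3(1,2)[folded l_def] l2 by (simp add: p_def coeff_mult_0 C_def L power2_eq_square)
  qed
  moreover have "poly p s \<noteq> 0 \<or> poly q s \<noteq> 0" if "s \<ge> 0" for s
  proof (rule ccontr)
    assume "\<not> ?thesis"
    then have z: "poly p s = 0" "poly v s = 0" by (simp_all add: q)
    have "poly W s \<noteq> 0" using that by (simp add: W_def X_def)
    \<comment> \<open>A joint zero forces R = l S and S = l R, hence R = S = 0 as l^2 differs from
      1; but R^2 + s S^2 = (1 + s)^(2j+1) is positive.\<close>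
    then have "poly R s = l * poly S s" "poly S s = l * poly R s"
      using z l2 by (simp_all add: p_def v_def C_def L)
    then have "poly R s * (1 - l\<^sup>2) = 0"  "poly S s = l * poly R s"
      by (simp_all add: algebra_simps power2_eq_square)
    then have "poly R s = 0" "poly S s = 0" using l2 by auto
    then show False using 4[of s] that by auto
  qed
  ultimately show ?thesis
    using E1 E2 unfolding L_def X_def[symmetric] X1 by blast
qed

section \<open>Identification of the recursively defined coefficients\<close>

lemma recursion_unique:
  fixes a b a' b' :: "nat \<Rightarrow> real"
  assumes "a 0 = a' 0" "b 0 = b' 0"
    and "\<And>n. 1 \<le> n \<Longrightarrow> n \<le> m \<Longrightarrow>
           2 * real n * a n - (2 * real m + 5 - 2 * real n) * a (n - 1) = - l * b (n - 1)"
    and "\<And>n. 1 \<le> n \<Longrightarrow> n \<le> m \<Longrightarrow>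
           (2 * real n + 3) * b n - (2 * real m + 2 - 2 * real n) * b (n - 1) = l * a n"
    and "\<And>n. 1 \<le> n \<Longrightarrow> n \<le> m \<Longrightarrow>
           2 * real n * a' n - (2 * real m + 5 - 2 * real n) * a' (n - 1) = - l * b' (n - 1)"
    and "\<And>n. 1 \<le> n \<Longrightarrow> n \<le> m \<Longrightarrow>
           (2 * real n + 3) * b' n - (2 * real m + 2 - 2 * real n) * b' (n - 1) = l * a' n"
  shows "n \<le> m \<Longrightarrow> a n = a' n \<and> b n = b' n"
proof (induction n)
  case (Suc n)
  then have IH: "a n = a' n" "b n = b' n" by auto
  have "2 * real (Suc n) * a (Suc n) = 2 * real (Suc n) * a' (Suc n)"
    using assms(3)[of "Suc n"] assms(5)[of "Suc n"] Suc.prems unfolding diff_Suc_1 IH by linarith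
  then have a: "a (Suc n) = a' (Suc n)" by simp
  have "(2 * real (Suc n) + 3) * b (Suc n) = (2 * real (Suc n) + 3) * b' (Suc n)"
    using assms(4)[of "Suc n"] assms(6)[of "Suc n"] Suc.prems unfolding diff_Suc_1 IH a by linarith
  moreover have "2 * real (Suc n) + 3 \<noteq> 0" by linarith
  ultimately show ?case using a by (metis mult_left_cancel)
qed (use assms in auto)

text \<open>The coefficient of s^(n-1) in the first equation and of s^n in the second are the two
  recursions, and the constant term of the second gives b_0. Since 2n and 2n + 3 do not vanish for n
  >= 1, the recursion has only one solution up to index m, and the degree bounds make the sums up to
  m the full polynomials.\<close>

lemma recursion_polys:
  fixes m j :: nat and a b :: "nat \<Rightarrow> real"
  assumes "1 \<le> j" and "j \<le> m + 1"
    and "a 0 = 1" and "b 0 = (2 * real j + 1) / 3"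
    and "\<And>n. 1 \<le> n \<Longrightarrow> n \<le> m \<Longrightarrow>
           2 * real n * a n - (2 * real m + 5 - 2 * real n) * a (n - 1) = - 3 * b 0 * b (n - 1)"
    and "\<And>n. 1 \<le> n \<Longrightarrow> n \<le> m \<Longrightarrow>
           (2 * real n + 3) * b n - (2 * real m + 2 - 2 * real n) * b (n - 1) = 3 * b 0 * a n"
  obtains p q :: "real poly" where
     "\<And>s. (\<Sum>n=0..m. a n * s ^ n) = poly p s" "\<And>s. (\<Sum>n=0..m. b n * s ^ n) = poly q s"
     "degree p \<le> m" "degree q \<le> m"
     "\<And>s. 2 * (1 + s) * poly (pderiv p) s = (2 * real m + 3) * poly p s - (2 * real j + 1) * poly q s"
     "\<And>s. 2 * s * (1 + s) * poly (pderiv q) s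
         = (2 * real m + 3) * s * poly q s - 3 * (1 + s) * poly q s + (2 * real j + 1) * poly p s"
     "\<And>s. s \<ge> 0 \<Longrightarrow> poly p s \<noteq> 0 \<or> poly q s \<noteq> 0"
proof -
  obtain p q :: "real poly" where
    1: "2 * [:1, 1:] * pderiv p = of_nat (2 * m + 3) * p - of_nat (2 * j + 1) * q" and
    2: "2 * [:0, 1:] * [:1, 1:] * pderiv q - of_nat (2 * m + 3) * [:0, 1:] * q + 3 * [:1, 1:] * q
       = of_nat (2 * j + 1) * p" and
    3: "coeff p 0 = 1" "degree p \<le> m" "degree q \<le> m"
     "\<And>s. s \<ge> 0 \<Longrightarrow> poly p s \<noteq> 0 \<or> poly q s \<noteq> 0"
    using weyl_dirac_radial_polys[OF assms(1,2)] by blast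
  define M l where "M = 2 * real m + 3" and "l = 2 * real j + 1"
  have num: "2 = [:2::real:]" "3 = [:3::real:]" "of_nat (2 * m + 3) = [:M:]" "of_nat (2 * j + 1) = [:l:]"
    by (simp_all only: numeral_poly of_nat_poly) (simp_all add: M_def l_def)
  note 1 = 1[unfolded num] and 2 = 2[unfolded num]
  have c1: "2 * (real (Suc n) * coeff p (Suc n)) + 2 * (real n * coeff p n) = M * coeff p n - l * coeff q n" for n
    using arg_cong[OF 1, of "\<lambda>f. coeff f n"]
    by (cases n) (simp_all add: coeff_pderiv algebra_simps)
  have c0: "3 * coeff q 0 = l"
    using arg_cong[OF 2, of "\<lambda>f. coeff f 0"] 3(1) by simp
  have c2: "2 * (real (Suc n) * coeff q (Suc n)) + 2 * (real n * coeff q n) - M * coeff q n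
     + 3 * coeff q (Suc n) + 3 * coeff q n = l * coeff p (Suc n)" for n
    using arg_cong[OF 2, of "\<lambda>f. coeff f (Suc n)"]
    by (cases n) (simp_all add: coeff_pderiv algebra_simps)
  have bl: "3 * b 0 = l" using assms by (simp add: l_def)
  have eq: "a n = coeff p n \<and> b n = coeff q n" if "n \<le> m" for n
  proof (rule recursion_unique[where l = l and m = m])
    show "a 0 = coeff p 0" "b 0 = coeff q 0" using 3 c0 bl assms by auto
    show "2 * real n * a n - (2 * real m + 5 - 2 * real n) * a (n - 1) = - l * b (n - 1)"
      if "1 \<le> n" "n \<le> m" for n using assms(5)[OF that] bl by simp
    show "(2 * real n + 3) * b n - (2 * real m + 2 - 2 * real n) * b (n - 1) = l * a n"
      if "1 \<le> n" "n \<le> m" for n using assms(6)[OF that] bl by simp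
    show "2 * real n * coeff p n - (2 * real m + 5 - 2 * real n) * coeff p (n - 1) = - l * coeff q (n - 1)"
      if "1 \<le> n" "n \<le> m" for n
      using c1[of "n - 1"] that by (cases n) (simp_all add: M_def algebra_simps)
    show "(2 * real n + 3) * coeff q n - (2 * real m + 2 - 2 * real n) * coeff q (n - 1) = l * coeff p n"
      if "1 \<le> n" "n \<le> m" for n
      using c2[of "n - 1"] that by (cases n) (simp_all add: M_def algebra_simps)
  qed (use that in auto)
  have sum_poly: "poly r s = (\<Sum>n=0..m. coeff r n * s ^ n)" if "degree r \<le> m" for r :: "real poly" and s
    unfolding poly_altdef
    by (rule sum.mono_neutral_left) (use that in \<open>auto simp: coeff_eq_0\<close>)
  show ?thesis
  proof (rule that)
    show "(\<Sum>n=0..m. a n * s ^ n) = poly p s" "(\<Sum>n=0..m. b n * s ^ n) = poly q s" for s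
      using eq by (simp_all add: sum_poly 3)
    show "2 * (1 + s) * poly (pderiv p) s = (2 * real m + 3) * poly p s - (2 * real j + 1) * poly q s" for s
      using arg_cong[OF 1, of "\<lambda>f. poly f s"] by (simp add: M_def l_def algebra_simps)
    show "2 * s * (1 + s) * poly (pderiv q) s
         = (2 * real m + 3) * s * poly q s - 3 * (1 + s) * poly q s + (2 * real j + 1) * poly p s" for s
      using arg_cong[OF 2, of "\<lambda>f. poly f s"] by (simp add: M_def l_def algebra_simps)
  qed (use 3 in auto)
qed

section \<open>Weak derivatives and square integrability\<close>

lemma integral_translation_diff:
  fixes h :: "'a::euclidean_space \<Rightarrow> 'b::{banach, second_countable_topology}"
  assumes "integrable lborel h"
  shows "integrable lborel (\<lambda>x. h (c + x) - h x)" "(LINT x|lborel. h (c + x) - h x) = 0"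
proof -
  have [measurable]: "h \<in> borel_measurable borel"
    using borel_measurable_integrable[OF assms] by simp
  have 1: "integrable lborel (\<lambda>x. h (c + x))"
    using integrable_distr_eq[of "(+) c" lborel borel h] assms by (simp add: lborel_distr_plus)
  have 2: "(LINT x|lborel. h (c + x)) = (LINT x|lborel. h x)"
    using integral_distr[of "(+) c" lborel borel h] by (simp add: lborel_distr_plus)
  show "integrable lborel (\<lambda>x. h (c + x) - h x)" "(LINT x|lborel. h (c + x) - h x) = 0"
    using 1 2 assms by simp_all
qed

lemma integrable_continuous_compact_support:
  fixes h :: "'a::euclidean_space \<Rightarrow> 'b::{banach, second_countable_topology}"
  assumes "continuous_on UNIV h" "compact K" "\<And>x. x \<notin> K \<Longrightarrow> h x = 0"
  shows "integrable lborel h"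
proof -
  have "integrable lborel (\<lambda>x. indicator K x *\<^sub>R h x)"
    using assms by (intro borel_integrable_compact continuous_on_subset[OF assms(1)]) auto
  also have "(\<lambda>x. indicator K x *\<^sub>R h x) = h"
    using assms(3) by (auto simp: indicator_def)
  finally show ?thesis .
qed

text \<open>The integral of a difference quotient vanishes by translation invariance; pass to the limit.\<close>

lemma integral_directional_derivative_compact_support:
  fixes h :: "'a::euclidean_space \<Rightarrow> 'b::euclidean_space"
  assumes der: "\<And>x. (h has_derivative h' x) (at x)"
    and cont: "continuous_on UNIV (\<lambda>x. h' x e)"
    and K: "compact K" "\<And>x. x \<notin> K \<Longrightarrow> h x = 0" "\<And>x. x \<notin> K \<Longrightarrow> h' x e = 0"
  shows "(LINT x|lborel. h' x e) = 0"
proof -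
  have conth: "continuous_on UNIV h"
    using has_derivative_continuous[OF der] by (simp add: continuous_at_imp_continuous_on)
  obtain M where M: "\<And>x. norm (h' x e) \<le> M"
  proof -
    have "bounded ((\<lambda>x. h' x e) ` K)"
      using K(1) cont by (meson compact_continuous_image compact_imp_bounded continuous_on_subset subset_UNIV)
    then obtain B where "\<And>x. x \<in> K \<Longrightarrow> norm (h' x e) \<le> B"
      unfolding bounded_iff by auto
    then have "norm (h' x e) \<le> max B 0" for x
      using K(3)[of x] by (cases "x \<in> K") (auto simp: le_max_iff_disj)
    then show ?thesis using that by blast
  qed
  have line: "((\<lambda>t. h (x + t *\<^sub>R e)) has_vector_derivative h' (x + t *\<^sub>R e) e) (at t within T)" for x t T
  proof -
    have "((\<lambda>t. h (x + t *\<^sub>R e)) has_derivative (\<lambda>u. h' (x + t *\<^sub>R e) (u *\<^sub>R e))) (at t within T)"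
      by (rule has_derivative_compose[OF _ der]) (auto intro!: derivative_eq_intros)
    then show ?thesis
      unfolding has_vector_derivative_def
      using linear_cmul[OF has_derivative_linear[OF der]] by simp
  qed
  \<comment> \<open>A bounded directional derivative makes h Lipschitz along e; this bounds all
    difference quotients by the same \<open>M\<close>.\<close>
  have lip: "norm (h (x + t *\<^sub>R e) - h x) \<le> M * t" if "t \<ge> 0" for x t
  proof -
    have "norm (h (x + t *\<^sub>R e) - h (x + 0 *\<^sub>R e)) \<le> M * norm (t - 0)"
    proof (rule differentiable_bound[of "{0..t}" "\<lambda>t. h (x + t *\<^sub>R e)"])
      show "((\<lambda>t. h (x + t *\<^sub>R e)) has_derivative (\<lambda>u. u *\<^sub>R h' (x + s *\<^sub>R e) e)) (at s within {0..t})" for s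
        using line unfolding has_vector_derivative_def .
      show "onorm (\<lambda>u. u *\<^sub>R h' (x + s *\<^sub>R e) e) \<le> M" for s
        by (rule onorm_bound) (use M[of "x + s *\<^sub>R e"] order_trans[OF norm_ge_zero M] in
            \<open>auto simp: mult.commute[of M] intro: mult_left_mono\<close>)
    qed (use that in auto)
    then show ?thesis using that by simp
  qed
  define d where "d n = inverse (real (Suc n))" for n
  have d: "0 < d n" "d n \<le> 1" for n
    by (simp_all add: d_def inverse_le_1_iff)
  define s where "s n x = (h (d n *\<^sub>R e + x) - h x) /\<^sub>R d n" for n x
  obtain r where r: "\<And>x. x \<in> K \<Longrightarrow> norm x \<le> r"
    using compact_imp_bounded[OF K(1)] unfolding bounded_iff by auto
  \<comment> \<open>Since \<open>d n\<close> is at most 1, a difference quotient can be nonzero only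
    within distance |e| of \<open>K\<close>, hence in this ball.\<close>
  define w where "w x = indicator (cball 0 (r + norm e)) x *\<^sub>R M" for x :: 'a
  have "(\<lambda>n. LINT x|lborel. s n x) \<longlonglongrightarrow> (LINT x|lborel. h' x e)"
  proof (rule integral_dominated_convergence[where w = w])
    show "(\<lambda>x. h' x e) \<in> borel_measurable lborel"
      using cont by (simp add: borel_measurable_continuous_onI)
    have [measurable]: "h \<in> borel_measurable borel"
      using conth by (simp add: borel_measurable_continuous_onI)
    show "s n \<in> borel_measurable lborel" for n
      unfolding s_def by measurable
    show "integrable lborel w"
      unfolding w_def by (rule borel_integrable_compact) auto
    show "AE x in lborel. (\<lambda>n. s n x) \<longlonglongrightarrow> h' x e"
    proof (rule AE_I2)
      fix x
      have "((\<lambda>t. (h (x + t *\<^sub>R e) - h x) /\<^sub>R t) \<longlongrightarrow> h' x e) (at 0)"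
      proof (rule LIM_zero_cancel, rule tendsto_norm_zero_cancel)
        have "((\<lambda>t. norm (h (x + t *\<^sub>R e) - h x - t *\<^sub>R h' x e) / norm t) \<longlongrightarrow> 0) (at 0)"
          using line[of x 0 UNIV] by (simp add: has_vector_derivative_def has_derivative_at)
        then show "((\<lambda>t. norm ((h (x + t *\<^sub>R e) - h x) /\<^sub>R t - h' x e)) \<longlongrightarrow> 0) (at 0)"
        proof (rule Lim_transform_eventually)
          show "\<forall>\<^sub>F t in at 0. norm (h (x + t *\<^sub>R e) - h x - t *\<^sub>R h' x e) / norm t
              = norm ((h (x + t *\<^sub>R e) - h x) /\<^sub>R t - h' x e)"
            unfolding eventually_at_filter
          proof (intro always_eventually allI impI)
            fix t :: real assume "t \<noteq> 0"
            then have "h (x + t *\<^sub>R e) - h x - t *\<^sub>R h' x e = t *\<^sub>R ((h (x + t *\<^sub>R e) - h x) /\<^sub>R t - h' x e)"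
              by (simp add: scaleR_diff_right)
            then show "norm (h (x + t *\<^sub>R e) - h x - t *\<^sub>R h' x e) / norm t
              = norm ((h (x + t *\<^sub>R e) - h x) /\<^sub>R t - h' x e)"
              using \<open>t \<noteq> 0\<close> by simp
          qed
        qed
      qed
      moreover have "filterlim d (at 0) sequentially"
        unfolding filterlim_at d_def using LIMSEQ_inverse_real_of_nat by auto
      ultimately show "(\<lambda>n. s n x) \<longlonglongrightarrow> h' x e"
        unfolding s_def by (auto dest: filterlim_compose simp: add.commute)
    qed
    show "AE x in lborel. norm (s n x) \<le> w x" for n
    proof (rule AE_I2)
      fix x
      show "norm (s n x) \<le> w x"
      proof (cases "norm x \<le> r + norm e")
        case True
        have "norm (s n x) = norm (h (x + d n *\<^sub>R e) - h x) / d n"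
          using d[of n] by (simp add: s_def add.commute divide_inverse mult.commute)
        also have "\<dots> \<le> M"
          using lip[of "d n" x] d[of n] by (simp add: pos_divide_le_eq)
        finally show ?thesis using True by (simp add: w_def)
      next
        case False
        have "norm (d n *\<^sub>R e) \<le> norm e"
          using d[of n] mult_right_mono[of "d n" 1 "norm e"] by simp
        then have "norm (x + d n *\<^sub>R e) > r"
          using False norm_diff_ineq[of x "d n *\<^sub>R e"] by linarith
        moreover have "norm x > r"
          using False norm_ge_zero[of e] by linarith
        ultimately have "h (x + d n *\<^sub>R e) = 0" "h x = 0"
          using r K(2) by (meson not_le)+
        then show ?thesis using False by (simp add: w_def s_def add.commute)
      qed
    qed
  qed
  moreover have "(LINT x|lborel. s n x) = 0" for n
    using integral_translation_diff[OF integrable_continuous_compact_support[OF conth K(1,2)], of "d n *\<^sub>R e"]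
    by (simp add: s_def)
  ultimately show ?thesis
    by (simp add: LIMSEQ_const_iff)
qed

lemma partial_deriv_eq:
  assumes "(f has_derivative f') (at x)"
  shows "partial_deriv k f x = f' (axis k 1)"
  using frechet_derivative_at[OF assms] by (simp add: partial_deriv_def)

text \<open>Integration by parts: the product of f with a test function has compact support, so the
  integral of its partial derivative vanishes.\<close>

lemma weak_partial_C1:
  fixes f :: "real^'n::finite \<Rightarrow> complex"
  assumes der: "\<And>x. (f has_derivative f' x) (at x)"
    and cont: "continuous_on UNIV (\<lambda>x. f' x (axis k 1))"
  shows "weak_partial k f (\<lambda>x. f' x (axis k 1))"
  unfolding weak_partial_def
proof (intro allI impI)
  fix \<phi> :: "real^'n \<Rightarrow> complex" assume \<phi>: "test_function \<phi>"
  define K where "K = closure {x. \<phi> x \<noteq> 0}"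
  have "C_times (Suc 0) \<phi>" and K: "compact K"
    using \<phi> by (auto simp: test_function_def K_def)
  then have d: "\<And>x. (\<phi> has_derivative frechet_derivative \<phi> (at x)) (at x)"
    and c: "continuous_on UNIV (partial_deriv k \<phi>)"
    by (auto simp: frechet_derivative_works)
  have K0: "\<phi> x = 0" if "x \<notin> K" for x
    using that closure_subset[of "{x. \<phi> x \<noteq> 0}"] by (auto simp: K_def)
  have K1: "partial_deriv k \<phi> x = 0" if "x \<notin> K" for x
  proof -
    have "open (- K)" by (simp add: K_def open_Compl)
    have "(\<phi> has_derivative (\<lambda>_. 0)) (at x)"
      by (rule has_derivative_transform_within_open[OF has_derivative_const \<open>open (- K)\<close>])
         (use that K0 in auto)
    then show ?thesis by (rule partial_deriv_eq)
  qed
  have cf: "continuous_on UNIV f" and c\<phi>: "continuous_on UNIV \<phi>"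
    using has_derivative_continuous[OF der] has_derivative_continuous[OF d]
    by (simp_all add: continuous_at_imp_continuous_on)
  define g where "g x = f' x (axis k 1)" for x
  have cg: "continuous_on UNIV g" using cont by (simp add: g_def[abs_def])
  have i1: "integrable lborel (\<lambda>x. f x * partial_deriv k \<phi> x)"
    by (rule integrable_continuous_compact_support[OF _ K]) (auto intro!: continuous_intros cf c simp: K1)
  have i2: "integrable lborel (\<lambda>x. g x * \<phi> x)"
    by (rule integrable_continuous_compact_support[OF _ K]) (auto intro!: continuous_intros cg c\<phi> simp: K0)
  have "(LINT x|lborel. f x * partial_deriv k \<phi> x + g x * \<phi> x) = 0"
    unfolding partial_deriv_def g_def
  proof (rule integral_directional_derivative_compact_support[where h = "\<lambda>x. f x * \<phi> x" and K = K])
    show "((\<lambda>x. f x * \<phi> x) has_derivative (\<lambda>e. f x * frechet_derivative \<phi> (at x) e + f' x e * \<phi> x)) (at x)" for x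
      by (rule has_derivative_mult[OF der d])
    show "continuous_on UNIV (\<lambda>x. f x * frechet_derivative \<phi> (at x) (axis k 1) + f' x (axis k 1) * \<phi> x)"
      using cf c cg c\<phi> unfolding partial_deriv_def g_def by (intro continuous_intros)
    show "f x * frechet_derivative \<phi> (at x) (axis k 1) + f' x (axis k 1) * \<phi> x = 0" if "x \<notin> K" for x
      using K0[OF that] K1[OF that] by (simp add: partial_deriv_def)
  qed (use K K0 in auto)
  then have "(LINT x|lborel. f x * partial_deriv k \<phi> x) = - (LINT x|lborel. g x * \<phi> x)"
    using i1 i2 by (simp add: eq_neg_iff_add_eq_0)
  \<comment> \<open>Borel measurability allows the passage from \<open>lborel\<close> to its
    completion \<open>lebesgue\<close>.\<close>
  moreover have "(\<lambda>x. f x * partial_deriv k \<phi> x) \<in> borel_measurable lborel"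
       "(\<lambda>x. g x * \<phi> x) \<in> borel_measurable lborel"
    using i1 i2 by auto
  ultimately show "(LINT x|lebesgue. f x * partial_deriv k \<phi> x) = - (LINT x|lebesgue. f' x (axis k 1) * \<phi> x)"
    by (simp add: integral_completion g_def)
qed

section \<open>Square integrability from decay in dimension three\<close>

lemma integrable_inverse_square_bracket:
  "integrable lborel (\<lambda>x::real^3. 1 / (1 + (norm x)\<^sup>2)\<^sup>2)"
proof (rule integrableI_bounded)
  let ?f = "\<lambda>x::real^3. 1 / (1 + (norm x)\<^sup>2)\<^sup>2"
  \<comment> \<open>on the dyadic shell \<open>B n - B (n - 1)\<close> the integrand is at most \<open>16 / 16\<^sup>n\<close>, while \<open>B n\<close> has volume
    proportional to \<open>8\<^sup>n\<close>\<close>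
  define B where "B n = (ball 0 (2 ^ n) :: (real^3) set)" for n :: nat
  define c :: "nat \<Rightarrow> ennreal" where "c n = ennreal (16 / 16 ^ n)" for n
  have [measurable]: "B n \<in> sets borel" for n
    by (simp add: B_def)
  show "?f \<in> borel_measurable lborel"
    by measurable
  have le: "ennreal (norm (?f x)) \<le> (\<Sum>n. c n * indicator (B n) x)" for x
  proof -
    \<comment> \<open>The least index is taken; the case n = 0 is separate because n - 1 is then
      truncated to 0.\<close>
    obtain n where n: "x \<in> B n" "n = 0 \<or> x \<notin> B (n - 1)"
    proof -
      have "\<exists>n. x \<in> B n"
        using real_arch_pow[of 2 "norm x"] by (auto simp: B_def)
      then have "x \<in> B (LEAST n. x \<in> B n)" by (rule LeastI_ex)
      moreover have "(LEAST n. x \<in> B n) = 0 \<or> x \<notin> B ((LEAST n. x \<in> B n) - 1)"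
        using not_less_Least[of "(LEAST n. x \<in> B n) - 1" "\<lambda>n. x \<in> B n"] by (cases "LEAST n. x \<in> B n") auto
      ultimately show ?thesis using that by blast
    qed
    have "?f x \<le> 16 / 16 ^ n"
    proof (cases n)
      case 0
      have "1 \<le> (1 + (norm x)\<^sup>2)\<^sup>2" by (simp add: one_le_power)
      then have "?f x \<le> 1" by (simp add: divide_le_eq_1)
      then show ?thesis using 0 by simp
    next
      case (Suc k)
      then have "2 ^ k \<le> norm x" using n by (simp add: B_def)
      then have "(2 ^ k)\<^sup>2 \<le> (norm x)\<^sup>2" by (rule power_mono) simp
      then have "(2 ^ k)\<^sup>2 \<le> 1 + (norm x)\<^sup>2" by linarith
      then have "((2 ^ k)\<^sup>2)\<^sup>2 \<le> (1 + (norm x)\<^sup>2)\<^sup>2" by (intro power_mono) simp_all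
      moreover have "((2 ^ k)\<^sup>2)\<^sup>2 = (16::real) ^ k"
        by (simp flip: power_mult add: mult.commute[of k] power_mult)
      ultimately have "?f x \<le> 1 / 16 ^ k" by (intro divide_left_mono mult_pos_pos zero_less_power add_pos_nonneg) simp_all
      then show ?thesis using Suc by simp
    qed
    then have "ennreal (norm (?f x)) \<le> c n * indicator (B n) x"
      using n by (simp add: c_def ennreal_leI)
    also have "\<dots> = sum (\<lambda>n. c n * indicator (B n) x) {n}" by (simp del: sum_mult_indicator)
    also have "\<dots> \<le> (\<Sum>n. c n * indicator (B n) x)"
      by (rule sum_le_suminf) auto
    finally show ?thesis .
  qed
  have "(\<integral>\<^sup>+ x. ennreal (norm (?f x)) \<partial>lborel) \<le> (\<integral>\<^sup>+ x. (\<Sum>n. c n * indicator (B n) x) \<partial>lborel)"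
    by (rule nn_integral_mono) (rule le)
  also have "\<dots> = (\<Sum>n. \<integral>\<^sup>+ x. c n * indicator (B n) x \<partial>lborel)"
    by (rule nn_integral_suminf) measurable
  also have "\<dots> = (\<Sum>n. ennreal (16 * unit_ball_vol 3 * (1 / 2) ^ n))"
  proof (rule suminf_cong)
    fix n
    have "(\<integral>\<^sup>+ x. c n * indicator (B n) x \<partial>lborel) = c n * emeasure lborel (B n)"
      by (rule nn_integral_cmult_indicator) simp
    also have "\<dots> = ennreal (16 / 16 ^ n * (unit_ball_vol 3 * (2 ^ n) ^ 3))"
      unfolding B_def c_def by (subst emeasure_ball) (simp_all add: ennreal_mult del: times_divide_eq_left)
    also have "16 / 16 ^ n * (unit_ball_vol 3 * (2 ^ n) ^ 3) = 16 * unit_ball_vol 3 * (1 / 2) ^ n"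
    proof -
      have "((2::real) ^ n) ^ 3 = 8 ^ n" by (simp flip: power_mult add: mult.commute[of n] power_mult)
      moreover have "(16::real) ^ n = 8 ^ n * 2 ^ n" by (simp flip: power_mult_distrib)
      ultimately show ?thesis by (simp add: field_simps)
    qed
    finally show "(\<integral>\<^sup>+ x. c n * indicator (B n) x \<partial>lborel) = ennreal (16 * unit_ball_vol 3 * (1 / 2) ^ n)" .
  qed
  also have "\<dots> < \<infinity>"
  proof -
    have "summable (\<lambda>n. 16 * unit_ball_vol 3 * (1 / 2) ^ n)"
      by (intro summable_mult summable_geometric) simp
    then show ?thesis
      by (subst suminf_ennreal2) auto
  qed
  finally show "(\<integral>\<^sup>+ x. ennreal (norm (?f x)) \<partial>lborel) < \<infinity>" .
qed

lemma L2_bound: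
  fixes f :: "real^3 \<Rightarrow> complex"
  assumes "continuous_on UNIV f" "\<And>x. cmod (f x) \<le> c / (1 + (norm x)\<^sup>2)"
  shows "L2 f"
proof -
  have m: "f \<in> borel_measurable borel"
    using assms(1) by (rule borel_measurable_continuous_onI)
  have "integrable lborel (\<lambda>x. (cmod (f x))\<^sup>2)"
  proof (rule Bochner_Integration.integrable_bound)
    show "integrable lborel (\<lambda>x::real^3. c\<^sup>2 * (1 / (1 + (norm x)\<^sup>2)\<^sup>2))"
      by (intro integrable_mult_right integrable_inverse_square_bracket)
    show "(\<lambda>x. (cmod (f x))\<^sup>2) \<in> borel_measurable lborel" using m by simp
    show "AE x in lborel. norm ((cmod (f x))\<^sup>2) \<le> norm (c\<^sup>2 * (1 / (1 + (norm x)\<^sup>2)\<^sup>2))"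
    proof (rule AE_I2)
      fix x
      have "(cmod (f x))\<^sup>2 \<le> (c / (1 + (norm x)\<^sup>2))\<^sup>2"
        using assms(2) by (rule power_mono) simp
      then show "norm ((cmod (f x))\<^sup>2) \<le> norm (c\<^sup>2 * (1 / (1 + (norm x)\<^sup>2)\<^sup>2))"
        by (simp add: power_divide)
    qed
  qed
  then show ?thesis
    unfolding L2_def using m by (auto simp: integrable_completion intro: measurable_completion)
qed

section \<open>Radial spinors\<close>

text \<open>With w_k = v . sigma_k v, the rank one matrix v v^* equals (|v|^2 I + w . sigma) / 2;
  applying both sides to v gives the identity. It is checked here in real and imaginary
  parts.\<close>

lemma sum_Re_cdot_pauli:
  "(\<Sum>k\<in>UNIV. Re (cdot v (pauli k *v v)) *\<^sub>R (pauli k *v v)) = (norm v)\<^sup>2 *\<^sub>R v"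
proof -
  have n: "(norm v)\<^sup>2 = (Re (v $ 1))\<^sup>2 + (Im (v $ 1))\<^sup>2 + ((Re (v $ 2))\<^sup>2 + (Im (v $ 2))\<^sup>2)"
    by (simp add: norm_vec_def L2_set_def sum_2 cmod_power2)
  show ?thesis
    unfolding n
    by (simp add: vec_eq_iff forall_2 sum_3 pauli_def matrix_vector_mult_def sum_2 cdot_def
        complex_eq_iff power2_eq_square)
       (simp add: algebra_simps)
qed

text \<open>Cauchy-Schwarz for the unitary Pauli matrices, reduced to 2ab <= a^2 + b^2. It bounds
  each component of the potential by 2j + 1.\<close>

lemma abs_Re_cdot_pauli_le: "\<bar>Re (cdot v (pauli k *v v))\<bar> \<le> (norm v)\<^sup>2"
proof -
  have n: "(norm v)\<^sup>2 = (Re (v $ 1))\<^sup>2 + (Im (v $ 1))\<^sup>2 + ((Re (v $ 2))\<^sup>2 + (Im (v $ 2))\<^sup>2)"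
    by (simp add: norm_vec_def L2_set_def sum_2 cmod_power2)
  have *: "\<bar>2 * (a * b + c * d)\<bar> \<le> a\<^sup>2 + c\<^sup>2 + (b\<^sup>2 + d\<^sup>2)" for a b c d :: real
    using sum_squares_bound[of a b] sum_squares_bound[of c d] sum_squares_bound[of "-a" b] sum_squares_bound[of "-c" d]
    by (auto simp: abs_le_iff)
  consider "k = 1" | "k = 2" | "k = 3" using exhaust_3 by blast
  then show ?thesis
  proof cases
    case 1
    have "Re (cdot v (pauli k *v v)) = 2 * (Re (v$1) * Re (v$2) + Im (v$1) * Im (v$2))"
      by (simp add: 1 pauli_def matrix_vector_mult_def sum_2 cdot_def algebra_simps)
    then show ?thesis unfolding n by (simp only: *)
  next
    case 2
    have "Re (cdot v (pauli k *v v)) = 2 * (Re (v$1) * Im (v$2) + (Im (v$1)) * (- Re (v$2)))"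
      by (simp add: 2 pauli_def matrix_vector_mult_def sum_2 cdot_def algebra_simps)
    then show ?thesis unfolding n using *[of "Re (v$1)" "Im (v$2)" "Im (v$1)" "- Re (v$2)"] by simp
  next
    case 3
    have "Re (cdot v (pauli k *v v)) = (Re (v$1))\<^sup>2 + (Im (v$1))\<^sup>2 - ((Re (v$2))\<^sup>2 + (Im (v$2))\<^sup>2)"
      by (simp add: 3 pauli_def matrix_vector_mult_def sum_2 cdot_def power2_eq_square algebra_simps)
    then show ?thesis unfolding n by (simp add: abs_le_iff add_increasing)
  qed
qed

lemma potential_plus_annihilates:
  assumes "v = \<psi> x" "v \<noteq> 0"
  shows "(\<Sum>k\<in>UNIV. pauli k *v (potential_plus j \<psi> x $ k *\<^sub>R v))
     = ((2 * real j + 1) / (1 + (norm x)\<^sup>2)) *\<^sub>R v"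
proof -
  have br: "(bracket x)\<^sup>2 = 1 + (norm x)\<^sup>2" by (simp add: bracket_def)
  define c where "c = (2 * real j + 1) / ((1 + (norm x)\<^sup>2) * (norm v)\<^sup>2)"
  have "(\<Sum>k\<in>UNIV. pauli k *v (potential_plus j \<psi> x $ k *\<^sub>R v))
    = c *\<^sub>R (\<Sum>k\<in>UNIV. Re (cdot v (pauli k *v v)) *\<^sub>R (pauli k *v v))"
    unfolding scaleR_right.sum
    by (rule sum.cong)
       (simp_all add: potential_plus_def br c_def assms(1) vec_eq_iff matrix_vector_mult_def scaleR_right.sum)
  also have "\<dots> = ((2 * real j + 1) / (1 + (norm x)\<^sup>2)) *\<^sub>R v"
    using assms(2) by (simp add: sum_Re_cdot_pauli c_def)
  finally show ?thesis .
qed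

lemma vector_potential_potential_plus:
  assumes "continuous_on UNIV \<psi>" "\<And>x. \<psi> x \<noteq> 0"
  shows "vector_potential (potential_plus j \<psi>)"
proof -
  have "continuous_on UNIV (potential_plus j \<psi>)"
    unfolding potential_plus_def cdot_def matrix_vector_mult_def bracket_def vec_lambda_beta
    by (intro continuous_intros assms(1)) (simp add: assms(2) add_nonneg_eq_0_iff)
  then have "potential_plus j \<psi> \<in> borel_measurable lebesgue"
    by (intro measurable_completion) (simp add: borel_measurable_continuous_onI)
  moreover have "norm (potential_plus j \<psi> x) \<le> (\<Sum>k\<in>(UNIV::3 set). 2 * real j + 1)" for x
  proof (rule order_trans[OF norm_le_l1_cart sum_mono])
    fix k :: 3
    have "(norm (\<psi> x))\<^sup>2 \<le> (bracket x)\<^sup>2 * (norm (\<psi> x))\<^sup>2"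
      by (simp add: bracket_def mult_le_cancel_right1)
    then have "\<bar>Re (cdot (\<psi> x) (pauli k *v \<psi> x))\<bar> / ((bracket x)\<^sup>2 * (norm (\<psi> x))\<^sup>2) \<le> 1"
      using order_trans[OF abs_Re_cdot_pauli_le] by (intro divide_le_eq_1[THEN iffD2]) (auto simp: assms)
    then have "(2 * real j + 1) * (\<bar>Re (cdot (\<psi> x) (pauli k *v \<psi> x))\<bar> / ((bracket x)\<^sup>2 * (norm (\<psi> x))\<^sup>2))
        \<le> (2 * real j + 1) * 1"
      by (intro mult_left_mono) auto
    then show "\<bar>potential_plus j \<psi> x $ k\<bar> \<le> 2 * real j + 1"
      by (simp add: potential_plus_def abs_mult)
  qed
  then have "bounded (range (potential_plus j \<psi>))"
    unfolding bounded_iff by blast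
  ultimately show ?thesis by (simp add: vector_potential_def)
qed

text \<open>The spinor \<open>(P + Q i\<sigma> \<cdot> x)\<phi>\<^sub>0\<close> written out in components.\<close>

definition radial_spinor :: "(real \<Rightarrow> real) \<Rightarrow> (real \<Rightarrow> real) \<Rightarrow> real^3 \<Rightarrow> complex^2" where
  "radial_spinor P Q x =
     vector [of_real (P (x \<bullet> x)) + \<i> * of_real (Q (x \<bullet> x) * x $ 3),
             \<i> * of_real (Q (x \<bullet> x) * x $ 1) - of_real (Q (x \<bullet> x) * x $ 2)]"

text \<open>The derivative at x in direction h. \<open>P'\<close> and \<open>Q'\<close> are
  derivatives in s = |x|^2, whence the factor 2 (x . h); \<open>D l\<close> is the derivative of Q
  x_l.\<close>

definition radial_spinor_deriv ::
  "(real \<Rightarrow> real) \<Rightarrow> (real \<Rightarrow> real) \<Rightarrow> (real \<Rightarrow> real) \<Rightarrow> real^3 \<Rightarrow> real^3 \<Rightarrow> complex^2" where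
  "radial_spinor_deriv P' Q Q' x h =
     (let D = \<lambda>l. Q' (x \<bullet> x) * (2 * (x \<bullet> h)) * x $ l + Q (x \<bullet> x) * h $ l in
     vector [of_real (P' (x \<bullet> x) * (2 * (x \<bullet> h))) + \<i> * of_real (D 3),
             \<i> * of_real (D 1) - of_real (D 2)])"

text \<open>At the origin Q drops out of the spinor, which explains the factor
  \<open>x \<bullet> x\<close> in front of it.\<close>

lemma radial_spinor_nonzero:
  assumes "P (x \<bullet> x) \<noteq> 0 \<or> x \<bullet> x * Q (x \<bullet> x) \<noteq> 0"
  shows "radial_spinor P Q x \<noteq> 0"
proof
  assume "radial_spinor P Q x = 0"
  then have "P (x \<bullet> x) = 0" "\<forall>k. Q (x \<bullet> x) * x $ k = 0"
    by (auto simp: radial_spinor_def vec_eq_iff forall_2 forall_3 complex_eq_iff)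
  then show False
    using assms by (auto simp: vec_eq_iff inner_vec_def)
qed

lemma has_derivative_radial:
  fixes x :: "real^3"
  assumes "(F has_real_derivative F') (at (x \<bullet> x))"
  shows "((\<lambda>x. F (x \<bullet> x)) has_derivative (\<lambda>h. F' * (2 * (x \<bullet> h)))) (at x)"
proof -
  have "((\<lambda>x. x \<bullet> x) has_derivative (\<lambda>h. 2 * (x \<bullet> h))) (at x)"
    by (auto intro!: derivative_eq_intros simp: inner_commute)
  from has_derivative_compose[OF this] assms show ?thesis
    unfolding has_field_derivative_def by blast
qed

lemma radial_spinor_has_derivative:
  assumes P: "\<And>s. s \<ge> 0 \<Longrightarrow> (P has_real_derivative P' s) (at s)"
    and Q: "\<And>s. s \<ge> 0 \<Longrightarrow> (Q has_real_derivative Q' s) (at s)"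
  shows "((\<lambda>x. radial_spinor P Q x $ i) has_derivative (\<lambda>h. radial_spinor_deriv P' Q Q' x h $ i)) (at x)"
proof -
  have dP: "((\<lambda>x. P (x \<bullet> x)) has_derivative (\<lambda>h. P' (x \<bullet> x) * (2 * (x \<bullet> h)))) (at x)"
    by (rule has_derivative_radial) (simp add: P)
  have dQ: "((\<lambda>x. Q (x \<bullet> x)) has_derivative (\<lambda>h. Q' (x \<bullet> x) * (2 * (x \<bullet> h)))) (at x)"
    by (rule has_derivative_radial) (simp add: Q)
  have dD: "((\<lambda>x. Q (x \<bullet> x) * x $ l) has_derivative
      (\<lambda>h. Q' (x \<bullet> x) * (2 * (x \<bullet> h)) * x $ l + Q (x \<bullet> x) * h $ l)) (at x)" for l
    by (rule has_derivative_eq_rhs[OF has_derivative_mult[OF dQ bounded_linear_imp_has_derivative[OF bounded_linear_vec_nth]]])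
       (simp add: fun_eq_iff)
  consider "i = 1" | "i = 2" using exhaust_2 by blast
  then show ?thesis
    by cases (auto simp: radial_spinor_def radial_spinor_deriv_def Let_def
        simp del: of_real_mult of_real_add
        intro!: has_derivative_add has_derivative_diff has_derivative_of_real has_derivative_mult_right dP dD)
qed

text \<open>Since (sigma . x)^2 = s I, applying sigma . D to P + i Q sigma . x gives 2 s Q' + 3 Q -
  2 i P' sigma . x; comparison with \<mu> (P + i Q sigma . x) yields the two hypotheses. The
  equation is pointwise, so \<mu> may depend on x when it is applied.\<close>

lemma radial_weyl_equation:
  fixes x :: "real^3"
  assumes "2 * P' (x \<bullet> x) = - \<mu> * Q (x \<bullet> x)"
    "2 * (x \<bullet> x) * Q' (x \<bullet> x) + 3 * Q (x \<bullet> x) = \<mu> * P (x \<bullet> x)"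
  shows "(\<Sum>k\<in>UNIV. pauli k *v ((- \<i>) *s radial_spinor_deriv P' Q Q' x (axis k 1)))
    = \<mu> *\<^sub>R radial_spinor P Q x"
proof -
  have x: "x \<bullet> x = x$1 * x$1 + x$2 * x$2 + x$3 * x$3"
    by (simp add: inner_vec_def sum_3)
  note e1 = assms(1) and e2 = assms(2)
  define s where "s = x \<bullet> x"
  have e2': "\<mu> * P s = 2 * (x$1 * x$1 + x$2 * x$2 + x$3 * x$3) * Q' s + 3 * Q s"
    using e2 unfolding s_def[symmetric] by (simp add: s_def x)
  have e1': "\<mu> * Q s = - (2 * P' s)"
    using e1 unfolding s_def[symmetric] by simp
  \<comment> \<open>The form in which the term occurs in the components, with y a coordinate of
    x.\<close>
  have e3: "\<mu> * (Q s * y) = - (2 * P' s * y)" for y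
    using e1' by (metis mult.assoc mult_minus_left)
  show ?thesis
    unfolding radial_spinor_def radial_spinor_deriv_def Let_def s_def[symmetric] inner_axis
    by (simp add: vec_eq_iff forall_2 sum_3 pauli_def matrix_vector_mult_def sum_2
        complex_eq_iff axis_def e2' e3)
       (simp add: algebra_simps)
qed

lemma abs_component_sq_le:
  fixes x :: "real^3"
  shows "\<bar>x $ k\<bar> \<le> sqrt (1 + x \<bullet> x)" "\<bar>x $ k * x $ l\<bar> \<le> x \<bullet> x"
proof -
  have n: "\<bar>x $ i\<bar> \<le> norm x" for i by (rule component_le_norm_cart)
  show "\<bar>x $ k\<bar> \<le> sqrt (1 + x \<bullet> x)"
    by (rule order_trans[OF n]) (simp add: norm_eq_sqrt_inner)
  show "\<bar>x $ k * x $ l\<bar> \<le> x \<bullet> x"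
    using mult_mono[OF n n] by (simp add: abs_mult dot_square_norm power2_eq_square)
qed

text \<open>Q enters the spinor multiplied by a coordinate of size at most sqrt(1 + s), hence the
  extra factor in its bound. The decay of the derivatives is obtained from the equations, which
  express P' and s Q' through P and Q.\<close>

lemma radial_spinor_zero_mode:
  fixes \<psi> :: "real^3 \<Rightarrow> complex^2"
  assumes P: "\<And>s. s \<ge> 0 \<Longrightarrow> (P has_real_derivative P' s) (at s)"
    and Q: "\<And>s. s \<ge> 0 \<Longrightarrow> (Q has_real_derivative Q' s) (at s)"
    and cont: "continuous_on {0..} P'" "continuous_on {0..} Q'"
    and ode: "\<And>s. s \<ge> 0 \<Longrightarrow> 2 * (1 + s) * P' s = - (2 * real j + 1) * Q s"
      "\<And>s. s \<ge> 0 \<Longrightarrow> (1 + s) * (2 * s * Q' s + 3 * Q s) = (2 * real j + 1) * P s"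
    and bnd: "\<And>s. s \<ge> 0 \<Longrightarrow> \<bar>P s\<bar> \<le> C / (1 + s)"
      "\<And>s. s \<ge> 0 \<Longrightarrow> \<bar>Q s\<bar> * sqrt (1 + s) \<le> C / (1 + s)"
    and nz: "\<And>s. s \<ge> 0 \<Longrightarrow> P s \<noteq> 0 \<or> s * Q s \<noteq> 0"
    and \<psi>: "\<psi> = radial_spinor P Q"
  shows "(\<forall>x. \<psi> x \<noteq> 0) \<and> vector_potential (potential_plus j \<psi>) \<and> zero_mode (potential_plus j \<psi>) \<psi>"
proof -
  define \<mu> where "\<mu> = 2 * real j + 1"
  have \<mu>: "\<mu> > 0" by (simp add: \<mu>_def)
  define D where "D = radial_spinor_deriv P' Q Q'"
  have nz': "\<psi> x \<noteq> 0" for x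
    unfolding \<psi> by (intro radial_spinor_nonzero nz) simp
  have der: "((\<lambda>x. \<psi> x $ i) has_derivative (\<lambda>h. D x h $ i)) (at x)" for i x
    unfolding \<psi> D_def by (rule radial_spinor_has_derivative[OF P Q])
  have cont\<psi>i: "continuous_on UNIV (\<lambda>x. \<psi> x $ i)" for i
    using has_derivative_continuous[OF der] by (simp add: continuous_at_imp_continuous_on)
  then have cont\<psi>: "continuous_on UNIV \<psi>"
    using continuous_on_vec_lambda[of UNIV "\<lambda>i x. \<psi> x $ i"] by simp
  have contr: "continuous_on UNIV (\<lambda>x::real^3. F (x \<bullet> x))" if "continuous_on {0..} F" for F :: "real \<Rightarrow> real"
    by (rule continuous_on_compose2[OF that]) (auto intro!: continuous_intros)
  have contQ: "continuous_on {0..} Q"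
    using Q by (meson DERIV_isCont atLeast_iff continuous_at_imp_continuous_on)
  have contD: "continuous_on UNIV (\<lambda>x. D x h $ i)" for h i
  proof -
    consider "i = 1" | "i = 2" using exhaust_2 by blast
    then show ?thesis
      by cases (auto simp: D_def radial_spinor_deriv_def Let_def intro!: continuous_intros contr cont contQ)
  qed
  have C: "C \<ge> 0" using bnd(1)[of 0] by simp
  have bQ: "\<bar>Q s\<bar> \<le> C / (1 + s)" if "s \<ge> 0" for s
  proof -
    have "\<bar>Q s\<bar> * 1 \<le> \<bar>Q s\<bar> * sqrt (1 + s)" using that by (intro mult_left_mono) auto
    then show ?thesis using bnd(2)[OF that] by simp
  qed
  have bQx: "\<bar>Q (x \<bullet> x) * x $ l\<bar> \<le> C / (1 + x \<bullet> x)" for x :: "real^3" and l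
    unfolding abs_mult
    by (rule order_trans[OF mult_left_mono[OF abs_component_sq_le(1)] bnd(2)]) auto
  have bP'x: "\<bar>P' (x \<bullet> x) * (2 * x $ k)\<bar> \<le> \<mu> * C / (1 + x \<bullet> x)" for x :: "real^3" and k
  proof -
    have s: "1 + x \<bullet> x \<ge> 1" by simp
    then have s0: "1 + x \<bullet> x \<noteq> 0" by linarith
    have "2 * P' (x \<bullet> x) = - \<mu> * Q (x \<bullet> x) / (1 + x \<bullet> x)"
      using ode(1)[of "x \<bullet> x"] s0 by (simp add: \<mu>_def eq_divide_eq eq_diff_eq algebra_simps)
    then have "P' (x \<bullet> x) * (2 * x $ k) = (- \<mu> * Q (x \<bullet> x) / (1 + x \<bullet> x)) * x $ k"
      by (metis mult.assoc mult.commute)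
    then have "\<bar>P' (x \<bullet> x) * (2 * x $ k)\<bar> = \<mu> * \<bar>Q (x \<bullet> x) * x $ k\<bar> / (1 + x \<bullet> x)"
      by (simp only: abs_mult abs_divide abs_minus abs_of_pos[OF \<mu>]
          abs_of_pos[OF order_less_le_trans[OF zero_less_one s]] times_divide_eq_left mult.assoc)
    also have "\<dots> \<le> \<mu> * \<bar>Q (x \<bullet> x) * x $ k\<bar> / 1"
      using \<mu> s by (intro divide_left_mono mult_pos_pos) (linarith | simp)+
    also have "\<dots> \<le> \<mu> * (C / (1 + x \<bullet> x))"
      using \<mu> mult_left_mono[OF bQx[of x k], of \<mu>] by simp
    finally show ?thesis by simp
  qed
  have bQ'x: "\<bar>Q' (x \<bullet> x) * (2 * x $ k) * x $ l\<bar> \<le> (\<mu> + 3) * C / (1 + x \<bullet> x)" for x :: "real^3" and k l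
  proof -
    have s: "1 + x \<bullet> x \<ge> 1" by simp
    then have s0: "1 + x \<bullet> x \<noteq> 0" by linarith
    have "\<bar>Q' (x \<bullet> x) * (2 * x $ k) * x $ l\<bar> = 2 * \<bar>Q' (x \<bullet> x)\<bar> * \<bar>x $ k * x $ l\<bar>"
      by (simp add: abs_mult)
    also have "\<dots> \<le> 2 * \<bar>Q' (x \<bullet> x)\<bar> * (x \<bullet> x)"
      by (intro mult_left_mono abs_component_sq_le) simp
    also have "\<dots> = \<bar>2 * (x \<bullet> x) * Q' (x \<bullet> x)\<bar>"
      by (simp add: abs_mult)
    \<comment> \<open>the equation bounds \<open>s Q'\<close> without an estimate of \<open>Q'\<close> itself\<close>
    also have "2 * (x \<bullet> x) * Q' (x \<bullet> x) = \<mu> * P (x \<bullet> x) / (1 + x \<bullet> x) - 3 * Q (x \<bullet> x)"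
      using ode(2)[of "x \<bullet> x"] s0 by (simp add: \<mu>_def field_simps)
    also have "\<bar>\<dots>\<bar> \<le> \<mu> * \<bar>P (x \<bullet> x)\<bar> / (1 + x \<bullet> x) + 3 * \<bar>Q (x \<bullet> x)\<bar>"
      using \<mu> s by (intro order_trans[OF abs_triangle_ineq4]) (simp add: abs_mult)
    also have "\<mu> * \<bar>P (x \<bullet> x)\<bar> / (1 + x \<bullet> x) \<le> \<mu> * \<bar>P (x \<bullet> x)\<bar> / 1"
      using \<mu> s by (intro divide_left_mono mult_pos_pos) (linarith | simp)+
    also have "\<mu> * \<bar>P (x \<bullet> x)\<bar> / 1 + 3 * \<bar>Q (x \<bullet> x)\<bar> \<le> \<mu> * (C / (1 + x \<bullet> x)) + 3 * (C / (1 + x \<bullet> x))"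
      unfolding div_by_1 using \<mu> by (intro add_mono mult_left_mono bnd(1) bQ) auto
    finally show ?thesis by (simp add: algebra_simps add_divide_distrib)
  qed
  \<comment> \<open>The constant is \<mu> + 3 from the term with Q', plus 1 from the derivative of
    the coordinate itself.\<close>
  have bD: "\<bar>Q' (x \<bullet> x) * (2 * x $ k) * x $ l + Q (x \<bullet> x) * axis k 1 $ l\<bar> \<le> (\<mu> + 4) * C / (1 + x \<bullet> x)"
    for x :: "real^3" and k l
  proof -
    have "\<bar>Q (x \<bullet> x) * axis k 1 $ l\<bar> \<le> C / (1 + x \<bullet> x)"
      using bQ[of "x \<bullet> x"] C by (auto simp: axis_def)
    then have "\<bar>Q' (x \<bullet> x) * (2 * x $ k) * x $ l + Q (x \<bullet> x) * axis k 1 $ l\<bar>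
       \<le> (\<mu> + 3) * C / (1 + x \<bullet> x) + C / (1 + x \<bullet> x)"
      by (intro order_trans[OF abs_triangle_ineq] add_mono bQ'x)
    then show ?thesis by (simp add: algebra_simps add_divide_distrib)
  qed
  have cm: "cmod (of_real u + \<i> * of_real v) \<le> \<bar>u\<bar> + \<bar>v\<bar>" "cmod (\<i> * of_real u - of_real v) \<le> \<bar>u\<bar> + \<bar>v\<bar>" for u v
    by (rule order_trans[OF norm_triangle_ineq], simp add: norm_mult,
        rule order_trans[OF norm_triangle_ineq4], simp add: norm_mult)
  have L2\<psi>: "L2 (\<lambda>x. \<psi> x $ i)" for i
  proof (rule L2_bound[OF cont\<psi>i])
    fix x :: "real^3"
    consider "i = 1" | "i = 2" using exhaust_2 by blast
    then have "cmod (\<psi> x $ i) \<le> C / (1 + x \<bullet> x) + C / (1 + x \<bullet> x)"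
    proof cases
      case 1
      show ?thesis unfolding 1 \<psi> radial_spinor_def vector_2
        by (intro order_trans[OF cm(1)] add_mono bnd(1) bQx) simp
    next
      case 2
      show ?thesis unfolding 2 \<psi> radial_spinor_def vector_2
        by (intro order_trans[OF cm(2)] add_mono bQx)
    qed
    then show "cmod (\<psi> x $ i) \<le> (2 * C) / (1 + (norm x)\<^sup>2)"
      by (simp add: dot_square_norm)
  qed
  have L2D: "L2 (\<lambda>x. D x (axis k 1) $ i)" for k i
  proof (rule L2_bound[OF contD])
    fix x :: "real^3"
    consider "i = 1" | "i = 2" using exhaust_2 by blast
    then have "cmod (D x (axis k 1) $ i) \<le> (\<mu> + 4) * C / (1 + x \<bullet> x) + (\<mu> + 4) * C / (1 + x \<bullet> x)"
    proof cases
      case 1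
      have "\<mu> * C / (1 + x \<bullet> x) \<le> (\<mu> + 4) * C / (1 + x \<bullet> x)"
        using C by (intro divide_right_mono mult_right_mono) auto
      note le = order_trans[OF bP'x this]
      show ?thesis unfolding 1 D_def radial_spinor_deriv_def Let_def vector_2 inner_axis inner_real_def mult_1_right
        by (intro order_trans[OF cm(1)] add_mono bD le)
    next
      case 2
      show ?thesis unfolding 2 D_def radial_spinor_deriv_def Let_def vector_2 inner_axis inner_real_def mult_1_right
        by (intro order_trans[OF cm(2)] add_mono bD)
    qed
    then show "cmod (D x (axis k 1) $ i) \<le> ((\<mu> + 4) * C + (\<mu> + 4) * C) / (1 + (norm x)\<^sup>2)"
      by (simp only: dot_square_norm add_divide_distrib)
  qed
  have wp: "weak_partial k (\<lambda>x. \<psi> x $ i) (\<lambda>x. D x (axis k 1) $ i)" for k i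
    by (rule weak_partial_C1[OF der contD])
  \<comment> \<open>The Dirac term and the potential term both equal \<mu> / (1 + |x|^2) times the
    spinor and cancel.\<close>
  have eq: "(\<Sum>k\<in>UNIV. pauli k *v ((- \<i>) *s D x (axis k 1) - potential_plus j \<psi> x $ k *\<^sub>R \<psi> x)) = 0" for x
  proof -
    have s: "1 + x \<bullet> x \<noteq> 0" by (metis add_nonneg_eq_0_iff inner_ge_zero zero_le_one zero_neq_one)
    have "(\<Sum>k\<in>UNIV. pauli k *v ((- \<i>) *s D x (axis k 1))) = (\<mu> / (1 + x \<bullet> x)) *\<^sub>R \<psi> x"
      unfolding D_def \<psi> using ode[of "x \<bullet> x"] s
      by (intro radial_weyl_equation) (simp_all add: \<mu>_def field_simps)
    moreover have "(\<Sum>k\<in>UNIV. pauli k *v (potential_plus j \<psi> x $ k *\<^sub>R \<psi> x)) = (\<mu> / (1 + x \<bullet> x)) *\<^sub>R \<psi> x"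
      using potential_plus_annihilates[where \<psi> = \<psi> and x = x and j = j, OF refl nz'] by (simp add: \<mu>_def dot_square_norm)
    ultimately show ?thesis
      by (simp only: matrix_vector_mult_diff_distrib sum_subtractf diff_self)
  qed
  have "H1 (\<lambda>x. \<psi> x $ i)" for i
    unfolding H1_def using L2\<psi> L2D wp by blast
  then have "zero_mode (potential_plus j \<psi>) \<psi>"
    unfolding zero_mode_def weyl_dirac_def
    by (intro conjI allI exI[of _ "\<lambda>k x. D x (axis k 1)"] AE_I2 L2D wp eq)
  with nz' vector_potential_potential_plus[OF cont\<psi> nz'] show ?thesis by blast
qed

section \<open>The explicit spinor as a radial one, and its decay\<close>

text \<open>The integer power of \<open>bracket x\<close> becomes a half-integer power of 1 + s, so
  that both profiles are differentiable functions of s on s >= 0.\<close>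

lemma psi_plus_eq_radial_spinor:
  "psi_plus m a b = radial_spinor
     (\<lambda>s. (1 + s) powr (- (real m + 3 / 2)) * (\<Sum>n=0..m. a n * s ^ n))
     (\<lambda>s. (1 + s) powr (- (real m + 3 / 2)) * (\<Sum>n=0..m. b n * s ^ n))"
proof
  fix x :: "real^3"
  have "bracket x powi (- (3 + 2 * int m)) = bracket x powr (- (3 + 2 * real m))"
    by (subst powr_real_of_int'[symmetric]) (simp_all add: bracket_def add_nonneg_eq_0_iff)
  also have "\<dots> = (1 + x \<bullet> x) powr (- (real m + 3 / 2))"
  proof -
    have "1 / 2 * (- (3 + 2 * real m)) = - (real m + 3 / 2)" by (simp add: field_simps)
    moreover have "bracket x = (1 + x \<bullet> x) powr (1 / 2)"
      by (simp add: bracket_def powr_half_sqrt dot_square_norm)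
    ultimately show ?thesis by (simp only: powr_powr)
  qed
  finally have w: "bracket x powi (- (3 + 2 * int m)) = (1 + x \<bullet> x) powr (- (real m + 3 / 2))" .
  have sum: "(\<Sum>n=0..m. c n * norm x ^ (2 * n)) = (\<Sum>n=0..m. c n * (x \<bullet> x) ^ n)" for c :: "nat \<Rightarrow> real"
    by (simp add: power_mult dot_square_norm)
  show "psi_plus m a b x = radial_spinor
     (\<lambda>s. (1 + s) powr (- (real m + 3 / 2)) * (\<Sum>n=0..m. a n * s ^ n))
     (\<lambda>s. (1 + s) powr (- (real m + 3 / 2)) * (\<Sum>n=0..m. b n * s ^ n)) x"
    unfolding psi_plus_def w sum radial_spinor_def
    by (simp add: vec_eq_iff forall_2 matrix_vector_mult_def matrix_matrix_mult_def sum_2 mat_def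
        sigma_dot_def sum_3 pauli_def complex_eq_iff algebra_simps)
qed

lemma poly_le_power:
  fixes r :: "real poly"
  assumes "degree r \<le> m" "s \<ge> 0"
  shows "\<bar>poly r s\<bar> \<le> (\<Sum>i\<le>degree r. \<bar>coeff r i\<bar>) * (1 + s) ^ m"
  unfolding poly_altdef sum_distrib_right
proof (rule order_trans[OF sum_abs sum_mono])
  fix i assume "i \<in> {..degree r}"
  then have "s ^ i \<le> (1 + s) ^ m"
    using assms by (intro order_trans[OF power_mono[of s "1 + s"] power_increasing]) auto
  then show "\<bar>coeff r i * s ^ i\<bar> \<le> \<bar>coeff r i\<bar> * (1 + s) ^ m"
    using assms by (simp add: abs_mult mult_left_mono)
qed

text \<open>A polynomial of degree at most m is O((1 + s)^m), and the exponents add up to -(m + 3/2)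
  + m + 1/2 = -1.\<close>

lemma powr_mult_poly_le:
  fixes r :: "real poly"
  assumes "degree r \<le> m" "s \<ge> 0"
  shows "\<bar>(1 + s) powr (- (real m + 3 / 2)) * poly r s\<bar> * sqrt (1 + s) \<le> (\<Sum>i\<le>degree r. \<bar>coeff r i\<bar>) / (1 + s)"
proof -
  have s: "1 + s > 0" using assms by simp
  have "(1 + s) powr (- (real m + 3 / 2)) * (1 + s) ^ m * sqrt (1 + s) = (1 + s) powr (- 1)"
    using s by (simp add: powr_half_sqrt[symmetric] flip: powr_realpow powr_add)
  also have "\<dots> = 1 / (1 + s)"
    using s by (simp add: powr_minus_divide)
  finally have e: "(1 + s) powr (- (real m + 3 / 2)) * (1 + s) ^ m * sqrt (1 + s) = 1 / (1 + s)" .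
  have "\<bar>(1 + s) powr (- (real m + 3 / 2)) * poly r s\<bar> * sqrt (1 + s)
     = (1 + s) powr (- (real m + 3 / 2)) * sqrt (1 + s) * \<bar>poly r s\<bar>"
    by (simp add: abs_mult)
  also have "\<dots> \<le> (1 + s) powr (- (real m + 3 / 2)) * sqrt (1 + s) * ((\<Sum>i\<le>degree r. \<bar>coeff r i\<bar>) * (1 + s) ^ m)"
    using s by (intro mult_left_mono poly_le_power assms) auto
  also have "\<dots> = (\<Sum>i\<le>degree r. \<bar>coeff r i\<bar>) * ((1 + s) powr (- (real m + 3 / 2)) * (1 + s) ^ m * sqrt (1 + s))"
    by (simp only: ac_simps)
  finally show ?thesis unfolding e by simp
qed

text \<open>Nonvanishing of \<psi> ensures that no division by zero with default value 0 hides in A;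
  the second conjunct makes A an admissible potential.\<close>

theorem mainTheorem2:
  fixes m j :: nat and a b :: "nat \<Rightarrow> real"
    and \<psi> :: "real^3 \<Rightarrow> complex^2" and A :: "real^3 \<Rightarrow> real^3"
  assumes "1 \<le> m" and "1 \<le> j" and "j \<le> m + 1"
    and "a 0 = 1" and "b 0 = (2 * real j + 1) / 3"
    and "\<And>n. 1 \<le> n \<Longrightarrow> n \<le> m \<Longrightarrow>
           2 * real n * a n - (2 * real m + 5 - 2 * real n) * a (n - 1) = - 3 * b 0 * b (n - 1)"
    and "\<And>n. 1 \<le> n \<Longrightarrow> n \<le> m \<Longrightarrow>
           (2 * real n + 3) * b n - (2 * real m + 2 - 2 * real n) * b (n - 1) = 3 * b 0 * a n"
    and "\<psi> = psi_plus m a b"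
    and "A = potential_plus j \<psi>"
  shows "(\<forall>x. \<psi> x \<noteq> 0) \<and> vector_potential A \<and> zero_mode A \<psi>"
proof -
  obtain p q :: "real poly" where
     ab: "\<And>s. (\<Sum>n=0..m. a n * s ^ n) = poly p s" "\<And>s. (\<Sum>n=0..m. b n * s ^ n) = poly q s" and
     deg: "degree p \<le> m" "degree q \<le> m" and
     odep: "\<And>s. 2 * (1 + s) * poly (pderiv p) s = (2 * real m + 3) * poly p s - (2 * real j + 1) * poly q s" and
     odeq: "\<And>s. 2 * s * (1 + s) * poly (pderiv q) s
         = (2 * real m + 3) * s * poly q s - 3 * (1 + s) * poly q s + (2 * real j + 1) * poly p s" and
     nz: "\<And>s. s \<ge> 0 \<Longrightarrow> poly p s \<noteq> 0 \<or> poly q s \<noteq> 0"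
    by (rule recursion_polys[OF assms(2-7)]) (assumption+, rule that)
  define W where "W s = (1 + s) powr (- (real m + 3 / 2))" for s :: real
  define W' where "W' s = - (real m + 3 / 2) * W s / (1 + s)" for s :: real
  have W0: "W s > 0" if "s \<ge> 0" for s using that by (simp add: W_def)
  have dW: "(W has_real_derivative W' s) (at s)" if "s \<ge> 0" for s
  proof -
    define k where "k = - (real m + 3 / 2)"
    have "((\<lambda>s. (1 + s) powr k) has_real_derivative (k * (1 + s) powr (k - 1)) * 1) (at s)"
      by (rule DERIV_chain2[OF has_real_derivative_powr]) (use that in \<open>auto intro!: derivative_eq_intros\<close>)
    then show ?thesis
      unfolding W_def[abs_def] W'_def k_def[symmetric] using that by (simp add: powr_diff)
  qed
  have contW: "continuous_on {0..} W"
    using dW by (meson DERIV_isCont atLeast_iff continuous_at_imp_continuous_on)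
  have contW': "continuous_on {0..} W'"
    unfolding W'_def by (intro continuous_intros contW) auto
  define P where "P s = W s * poly p s" for s
  define Q where "Q s = W s * poly q s" for s
  define P' where "P' s = W' s * poly p s + W s * poly (pderiv p) s" for s
  define Q' where "Q' s = W' s * poly q s + W s * poly (pderiv q) s" for s
  define C where "C = max (\<Sum>i\<le>degree p. \<bar>coeff p i\<bar>) (\<Sum>i\<le>degree q. \<bar>coeff q i\<bar>)"
  have bnd: "\<bar>P s\<bar> * sqrt (1 + s) \<le> C / (1 + s)" "\<bar>Q s\<bar> * sqrt (1 + s) \<le> C / (1 + s)" if "s \<ge> 0" for s
  proof -
    have *: "(\<Sum>i\<le>degree r. \<bar>coeff r i\<bar>) / (1 + s) \<le> C / (1 + s)" if "r = p \<or> r = q" for r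
      using that \<open>s \<ge> 0\<close> by (intro divide_right_mono) (auto simp: C_def)
    show "\<bar>P s\<bar> * sqrt (1 + s) \<le> C / (1 + s)"
      unfolding P_def W_def by (rule order_trans[OF powr_mult_poly_le[OF deg(1) that] *]) simp
    show "\<bar>Q s\<bar> * sqrt (1 + s) \<le> C / (1 + s)"
      unfolding Q_def W_def by (rule order_trans[OF powr_mult_poly_le[OF deg(2) that] *]) simp
  qed
  have \<psi>: "\<psi> = radial_spinor P Q"
    unfolding assms(8) psi_plus_eq_radial_spinor ab P_def Q_def W_def ..
  have W's: "(1 + s) * W' s = - (real m + 3 / 2) * W s" if "s \<ge> 0" for s
    using that by (simp add: W'_def)
  show ?thesis
    unfolding assms(9)
  proof (rule radial_spinor_zero_mode[where P = P and Q = Q and P' = P' and Q' = Q' and C = C])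
    fix s :: real assume s: "s \<ge> 0"
    show "(P has_real_derivative P' s) (at s)" "(Q has_real_derivative Q' s) (at s)"
      unfolding P_def P'_def Q_def Q'_def
      by (auto intro!: derivative_eq_intros dW s)
    \<comment> \<open>The derivative of the weight contributes -(2m + 3) P, which cancels the (2m +
      3) p of the polynomial equation.\<close>
    have "2 * (1 + s) * P' s = 2 * ((1 + s) * W' s) * poly p s + W s * (2 * (1 + s) * poly (pderiv p) s)"
      by (simp add: P'_def algebra_simps)
    also have "\<dots> = - (2 * real j + 1) * Q s"
      unfolding W's[OF s] odep by (simp add: Q_def algebra_simps)
    finally show "2 * (1 + s) * P' s = - (2 * real j + 1) * Q s" .
    \<comment> \<open>The same cancellation, with s Q; the terms 3 (1 + s) Q cancel as well.\<close>
    have "(1 + s) * (2 * s * Q' s + 3 * Q s)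
       = 2 * s * ((1 + s) * W' s) * poly q s + W s * (2 * s * (1 + s) * poly (pderiv q) s) + 3 * (1 + s) * Q s"
      by (simp add: Q'_def algebra_simps)
    also have "\<dots> = (2 * real j + 1) * P s"
      unfolding W's[OF s] odeq by (simp add: P_def Q_def algebra_simps)
    finally show "(1 + s) * (2 * s * Q' s + 3 * Q s) = (2 * real j + 1) * P s" .
    show "\<bar>Q s\<bar> * sqrt (1 + s) \<le> C / (1 + s)" using bnd s by simp
    have "\<bar>P s\<bar> * 1 \<le> \<bar>P s\<bar> * sqrt (1 + s)" using s by (intro mult_left_mono) auto
    then show "\<bar>P s\<bar> \<le> C / (1 + s)" using bnd(1)[OF s] by simp
    show "P s \<noteq> 0 \<or> s * Q s \<noteq> 0"
    proof (cases "s = 0")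
      case True
      \<comment> \<open>At the origin only P contributes, and P(0) is positive because a_0 =
        1.\<close>
      have "poly p 0 = 1" using ab(1)[of 0] assms(4) by (simp add: power_0_left if_distrib cong: if_cong)
      then show ?thesis using W0[of 0] by (simp add: P_def True)
    next
      case False
      then show ?thesis using nz[OF s] W0[OF s] by (auto simp: P_def Q_def)
    qed
  next
    show "continuous_on {0..} P'" "continuous_on {0..} Q'"
      unfolding P'_def Q'_def by (intro continuous_intros contW contW')+
  qed (rule \<psi>)
qed

end
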